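(* For every compact abelian group $G$ and every finite set $D\subset G\setminus\{0\}$ with $|D|\le 3$, the Motzkin density $\mathrm{Md}_G(D)$ is a rational number.
   Context: Compact abelian groups are Hausdorff; $\mu$ denotes the Haar probability measure on $G$. For $D\subset G$, a set $A\subset G$ is $D$-avoiding if $(A-A)\cap D=\emptyset$. The Motzkin density is $\mathrm{Md}_G(D)=\sup\{\mu(A): A\subset G \text{ Borel},\ (A-A)\cap D=\emptyset\}$. *)

theory Defs
  imports "HOL-Analysis.Analysis" "HOL-Probability.Probability"
begin

definition haar_prob :: "'a::{topological_ab_group_add,t2_space} measure \<Rightarrow> bool" where
  "haar_prob \<mu> \<longleftrightarrow>
     prob_space \<mu> \<and> sets \<mu> = sets borel \<and>
     (\<forall>x. \<forall>A\<in>sets borel. emeasure \<mu> ((\<lambda>y. x + y) ` A) = emeasure \<mu> A) \<and>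
     (\<forall>A\<in>sets borel. emeasure \<mu> A = (INF U\<in>{U. open U \<and> A \<subseteq> U}. emeasure \<mu> U)) \<and>
     (\<forall>U. open U \<longrightarrow> emeasure \<mu> U = (SUP K\<in>{K. compact K \<and> K \<subseteq> U}. emeasure \<mu> K))"

definition avoiding :: "'a::ab_group_add set \<Rightarrow> 'a set \<Rightarrow> bool" where
  "avoiding D A \<longleftrightarrow> (\<forall>x\<in>A. \<forall>y\<in>A. x - y \<notin> D)"

definition motzkin_density :: "'a::{topological_ab_group_add,t2_space} measure \<Rightarrow> 'a set \<Rightarrow> real" where
  "motzkin_density \<mu> D = Sup {measure \<mu> A | A. A \<in> sets borel \<and> avoiding D A}"

end

theory Submission
  imports Defs "HOL-Combinatorics.Permutations" "HOL-Real_Asymp.Real_Asymp"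
begin

text \<open>
  Averaging over translates shows that \<open>card F * Md(D)\<close> is at most the size of the largest
  \<open>D\<close>-avoiding subset of a finite set \<open>F\<close>; conversely a randomised local rule turns a finite
  \<open>D\<close>-avoiding set \<open>I\<close> into Borel \<open>D\<close>-avoiding sets of measure \<open>card I / card F\<close>, for any finite
  \<open>F\<close> containing \<open>I\<close>, \<open>I + D\<close> and \<open>I - D\<close>. So the density only depends on the group generated
  by \<open>D = {d1, d2, d3}\<close>, hence on the lattice of relations \<open>a d1 + b d2 + c d3 = 0\<close>.
  If all relations have even coordinate sum, parity makes the Cayley graph bipartite and the density
  is \<open>1/2\<close>. If the relations have rank one and some are odd, then after changing signs the shortest
  odd relation is an odd cycle of length \<open>n\<close> and coordinate sum is a homomorphism to \<open>\<int>/n\<close>, so the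
  density is \<open>(n - 1)/(2n)\<close>. If they have rank at least two, the group is finite or virtually cyclic
  and the density is a maximal cycle mean in a finite graph.
\<close>

section \<open>Reduction to finite sets\<close>

text \<open>Composing with the transposition of \<open>a\<close> and \<open>b\<close> turns a
  permutation that is least on \<open>J\<close> at \<open>a\<close> into one that is least at
  \<open>b\<close>. So all positions in \<open>J\<close> are equally likely to carry the least
  value, and by injectivity exactly one of them does.\<close>

lemma card_permutations_least_at:
  fixes m :: nat
  assumes "J \<subseteq> {..<m}" "j \<in> J"
  shows "card J * card {\<sigma>. \<sigma> permutes {..<m} \<and> (\<forall>j'\<in>J. \<sigma> j \<le> \<sigma> j')} = fact m"
proof -
  define N where "N j = {\<sigma>. \<sigma> permutes {..<m} \<and> (\<forall>j'\<in>J. \<sigma> j \<le> \<sigma> j')}" for j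
  have finJ: "finite J" using assms(1) finite_subset by blast
  have finP: "finite {\<sigma>. \<sigma> permutes {..<m}}" by (simp add: finite_permutations)
  have finN: "finite (N k)" for k
    by (rule finite_subset[OF _ finP]) (auto simp: N_def)
  have le: "card (N a) \<le> card (N b)" if ab: "a \<in> J" "b \<in> J" for a b
  proof (rule card_inj_on_le[where f = "\<lambda>\<sigma>. \<sigma> \<circ> Transposition.transpose a b"])
    show "inj_on (\<lambda>\<sigma>. \<sigma> \<circ> Transposition.transpose a b) (N a)"
      by (rule inj_onI) (metis comp_assoc comp_id transpose_comp_involutory)
    show "(\<lambda>\<sigma>. \<sigma> \<circ> Transposition.transpose a b) ` N a \<subseteq> N b"
    proof clarify
      fix \<sigma> assume s: "\<sigma> \<in> N a"
      have "Transposition.transpose a b permutes {..<m}"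
        using ab assms(1) by (intro permutes_swap_id) auto
      moreover have "Transposition.transpose a b x \<in> J" if "x \<in> J" for x
        using ab that by (auto simp: Transposition.transpose_def)
      ultimately show "\<sigma> \<circ> Transposition.transpose a b \<in> N b"
        using s by (auto simp: N_def intro: permutes_compose)
    qed
    show "finite (N b)" by (rule finN)
  qed
  have "{\<sigma>. \<sigma> permutes {..<m}} = (\<Union>k\<in>J. N k)"
  proof
    show "{\<sigma>. \<sigma> permutes {..<m}} \<subseteq> (\<Union>k\<in>J. N k)"
    proof
      fix \<sigma> assume "\<sigma> \<in> {\<sigma>. \<sigma> permutes {..<m}}"
      moreover obtain k where "k \<in> J" "\<forall>j'\<in>J. \<sigma> k \<le> \<sigma> j'"
        using finJ assms(2) ex_is_arg_min_if_finite[of J \<sigma>]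
        by (auto simp: is_arg_min_linorder)
      ultimately show "\<sigma> \<in> (\<Union>k\<in>J. N k)" by (auto simp: N_def)
    qed
  qed (auto simp: N_def)
  moreover have "card (\<Union>k\<in>J. N k) = (\<Sum>k\<in>J. card (N k))"
  proof (rule card_UN_disjoint[OF finJ])
    show "\<forall>k\<in>J. finite (N k)" using finN by blast
    show "\<forall>i\<in>J. \<forall>j\<in>J. i \<noteq> j \<longrightarrow> N i \<inter> N j = {}"
    proof (intro ballI impI, rule ccontr)
      fix a b assume ab: "a \<in> J" "b \<in> J" "a \<noteq> b" "N a \<inter> N b \<noteq> {}"
      then obtain \<sigma> where "\<sigma> \<in> N a" "\<sigma> \<in> N b" by blast
      then have "\<sigma> permutes {..<m}" "\<sigma> a = \<sigma> b"
        using ab by (auto simp: N_def intro: antisym)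
      then show False using ab(3) permutes_inj injD by metis
    qed
  qed
  moreover have "card (N k) = card (N j)" if "k \<in> J" for k
    using le that assms(2) by (meson antisym)
  ultimately have "card {\<sigma>. \<sigma> permutes {..<m}} = (\<Sum>k\<in>J. card (N j))" by simp
  then have "fact m = card J * card (N j)"
    using card_permutations[of "{..<m}" m] by simp
  then show ?thesis by (simp add: N_def)
qed

section \<open>Averaging over Haar measure and local rules\<close>

locale haar_group =
  fixes \<mu> :: "'a::{topological_ab_group_add,t2_space} measure"
  assumes compact_UNIV: "compact (UNIV :: 'a set)"
    and haar: "haar_prob \<mu>"
begin

lemma prob_space: "prob_space \<mu>" and sets_mu [measurable_cong]: "sets \<mu> = sets borel"
  using haar by (auto simp: haar_prob_def)

lemma space_mu: "space \<mu> = UNIV"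
  using sets_eq_imp_space_eq[OF sets_mu] by simp

sublocale prob_space \<mu> by (rule prob_space)

lemma borel_translation [measurable]: "(\<lambda>x::'a. x + c) \<in> borel \<rightarrow>\<^sub>M borel"
  by (intro borel_measurable_continuous_onI continuous_intros)

lemma borel_translation_minus [measurable]: "(\<lambda>x::'a. x - c) \<in> borel \<rightarrow>\<^sub>M borel"
  by (intro borel_measurable_continuous_onI continuous_intros)

lemma translate_borel: "A \<in> sets borel \<Longrightarrow> {x::'a. x + c \<in> A} \<in> sets borel"
  using measurable_sets[OF borel_translation, of A c] by (simp add: vimage_def)

lemma measure_translate:
  assumes "A \<in> sets borel"
  shows "measure \<mu> {x. x + c \<in> A} = measure \<mu> A"
proof -
  have "{x. x + c \<in> A} = (\<lambda>y. - c + y) ` A"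
    by (auto simp: image_iff intro!: bexI[of _ "_ + c"])
  moreover have "emeasure \<mu> ((\<lambda>y. - c + y) ` A) = emeasure \<mu> A"
  proof -
    have "\<forall>x. \<forall>A\<in>sets borel. emeasure \<mu> ((\<lambda>y. x + y) ` A) = emeasure \<mu> A"
      using haar unfolding haar_prob_def by (elim conjE)
    then show ?thesis using assms by blast
  qed
  ultimately show ?thesis by (simp only: measure_def)
qed

text \<open>The left side is the integral of the number of sets \<open>B j\<close> that contain
  \<open>x\<close>.\<close>

lemma sum_measure_le:
  assumes "finite J" "\<And>j. j \<in> J \<Longrightarrow> B j \<in> sets borel"
    and "\<And>x. real (card {j\<in>J. x \<in> B j}) \<le> k"
  shows "(\<Sum>j\<in>J. measure \<mu> (B j)) \<le> k"
proof -
  have int: "integrable \<mu> (\<lambda>x. indicat_real (B j) x)" if "j \<in> J" for j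
    using assms(2)[OF that]
    by (auto simp: integrable_indicator_iff emeasure_eq_measure sets_mu space_mu)
  have "(\<Sum>j\<in>J. measure \<mu> (B j)) = (\<Sum>j\<in>J. expectation (indicat_real (B j)))"
    using space_mu by simp
  also have "\<dots> = expectation (\<lambda>x. \<Sum>j\<in>J. indicat_real (B j) x)"
    by (rule Bochner_Integration.integral_sum[symmetric]) (rule int)
  also have "\<dots> \<le> expectation (\<lambda>x. k)"
  proof (rule integral_mono)
    show "integrable \<mu> (\<lambda>x. \<Sum>j\<in>J. indicat_real (B j) x)" using int by simp
    fix x
    have "(\<Sum>j\<in>J. indicat_real (B j) x) = real (card {j\<in>J. x \<in> B j})"
      using assms(1) by (simp add: indicator_def sum.If_cases Int_def)
    then show "(\<Sum>j\<in>J. indicat_real (B j) x) \<le> k" using assms(3) by simp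
  qed simp
  finally show ?thesis by (simp add: prob_space)
qed

text \<open>Passing to complements reduces this to \<open>sum_measure_le\<close>.\<close>

lemma sum_measure_ge:
  assumes "finite J" "\<And>j. j \<in> J \<Longrightarrow> B j \<in> sets borel"
    and "\<And>x. k \<le> real (card {j\<in>J. x \<in> B j})"
  shows "k \<le> (\<Sum>j\<in>J. measure \<mu> (B j))"
proof -
  have "(\<Sum>j\<in>J. measure \<mu> (UNIV - B j)) \<le> real (card J) - k"
  proof (rule sum_measure_le[OF assms(1)])
    fix x
    have "card {j\<in>J. x \<in> UNIV - B j} = card (J - {j\<in>J. x \<in> B j})"
      by (rule arg_cong[where f = card]) auto
    also have "real \<dots> = real (card J) - real (card {j\<in>J. x \<in> B j})"
      using assms(1) by (subst card_Diff_subset) (auto simp: card_mono of_nat_diff)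
    finally show "real (card {j\<in>J. x \<in> UNIV - B j}) \<le> real (card J) - k"
      using assms(3)[of x] by simp
  qed (use assms(2) in auto)
  moreover have "(\<Sum>j\<in>J. measure \<mu> (UNIV - B j)) = (\<Sum>j\<in>J. 1 - measure \<mu> (B j))"
    using assms(2) prob_compl by (intro sum.cong) (simp_all add: sets_mu space_mu)
  ultimately show ?thesis by (simp add: sum_subtractf)
qed

lemma measure_le_motzkin_density:
  assumes "A \<in> sets borel" "avoiding D A"
  shows "measure \<mu> A \<le> motzkin_density \<mu> D"
  unfolding motzkin_density_def
proof (rule cSup_upper)
  show "bdd_above {measure \<mu> A |A. A \<in> sets borel \<and> avoiding D A}"
    by (rule bdd_aboveI[of _ 1]) auto
qed (use assms in blast)

lemma motzkin_density_le:
  assumes "\<And>A. A \<in> sets borel \<Longrightarrow> avoiding D A \<Longrightarrow> measure \<mu> A \<le> k"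
  shows "motzkin_density \<mu> D \<le> k"
  unfolding motzkin_density_def
proof (rule cSup_least)
  have "{} \<in> sets (borel :: 'a measure)" "avoiding D {}" by (auto simp: avoiding_def)
  then show "{measure \<mu> A |A. A \<in> sets borel \<and> avoiding D A} \<noteq> {}" by blast
qed (use assms in auto)

lemma motzkin_density_nonneg: "0 \<le> motzkin_density \<mu> D"
  using measure_le_motzkin_density[of "{}" D] by (simp add: avoiding_def)

text \<open>For a Borel avoiding \<open>A\<close>, the translates
  \<open>{x. x + s j \<in> A}\<close> all have the measure of \<open>A\<close>. Each
  \<open>x\<close> lies in at most \<open>k\<close> of them, because
  \<open>{y. x + y \<in> A}\<close> is again avoiding. The family \<open>s\<close> may repeat
  points, so closed walks can be counted by position.\<close>

lemma motzkin_density_upper: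
  fixes s :: "'b \<Rightarrow> 'a"
  assumes "finite J" "\<And>A. avoiding D A \<Longrightarrow> real (card {j\<in>J. s j \<in> A}) \<le> k"
  shows "real (card J) * motzkin_density \<mu> D \<le> k"
proof (cases "J = {}")
  case True
  then show ?thesis using assms(2)[of "{}"] by (simp add: avoiding_def)
next
  case False
  then have pos: "0 < real (card J)" using assms(1) by (simp add: card_gt_0_iff)
  have "motzkin_density \<mu> D \<le> k / real (card J)"
  proof (rule motzkin_density_le)
    fix A :: "'a set" assume A: "A \<in> sets borel" "avoiding D A"
    have "(\<Sum>j\<in>J. measure \<mu> {x. x + s j \<in> A}) \<le> k"
    proof (rule sum_measure_le[OF assms(1)])
      show "{x. x + s j \<in> A} \<in> sets borel" for j
        using A(1) by (rule translate_borel)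
      fix x
      have "avoiding D {y. x + y \<in> A}"
        using A(2) unfolding avoiding_def by (metis add_diff_cancel_left mem_Collect_eq)
      from assms(2)[OF this] show "real (card {j \<in> J. x \<in> {x. x + s j \<in> A}}) \<le> k" by simp
    qed
    then have "real (card J) * measure \<mu> A \<le> k"
      using A(1) by (simp add: measure_translate)
    then show "measure \<mu> A \<le> k / real (card J)" using pos by (simp add: field_simps)
  qed
  then show ?thesis using pos by (simp add: field_simps)
qed

text \<open>By continuity of subtraction some open \<open>U\<close> around 0 has no difference in
  \<open>S\<close>. By compactness finitely many translates of \<open>U\<close> cover the group; a
  point is coloured by the first translate that contains it. Points of one colour then differ by an
  element of \<open>U - U\<close>, which misses \<open>S\<close>.\<close>

lemma finite_borel_coloring:
  fixes S :: "'a set"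
  assumes "finite S" "0 \<notin> S"
  obtains m and c :: "'a \<Rightarrow> nat"
  where "c \<in> borel \<rightarrow>\<^sub>M count_space UNIV" "\<And>x. c x < m" "\<And>x s. s \<in> S \<Longrightarrow> c (x + s) \<noteq> c x"
proof -
  have "closed S" using assms(1) by (rule finite_imp_closed)
  then have "open ((\<lambda>p::'a\<times>'a. fst p - snd p) -` (- S))"
    by (intro open_vimage continuous_intros) auto
  moreover have "(0,0) \<in> (\<lambda>p::'a\<times>'a. fst p - snd p) -` (- S)" using assms(2) by simp
  ultimately obtain P Q where PQ: "open P" "open Q" "(0,0) \<in> P \<times> Q"
    "P \<times> Q \<subseteq> (\<lambda>p::'a\<times>'a. fst p - snd p) -` (- S)"
    by (rule open_prod_elim)
  define U where "U = P \<inter> Q"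
  have U: "open U" "0 \<in> U" "\<And>u v. u \<in> U \<Longrightarrow> v \<in> U \<Longrightarrow> u - v \<notin> S"
    using PQ by (auto simp: U_def)
  define V where "V y = {x. x + y \<in> U}" for y
  have openV: "open (V y)" for y
  proof -
    have "open ((\<lambda>x. x + y) -` U)"
      using U(1) by (intro open_vimage continuous_intros)
    then show ?thesis by (simp add: V_def vimage_def)
  qed
  have "UNIV \<subseteq> (\<Union>y\<in>UNIV. V y)"
  proof
    fix x :: 'a
    have "x \<in> V (- x)" using U(2) by (simp add: V_def)
    then show "x \<in> (\<Union>y\<in>UNIV. V y)" by blast
  qed
  with compact_UNIV openV obtain Y where Y: "finite Y" "UNIV \<subseteq> (\<Union>y\<in>Y. V y)"
    by (metis compactE_image)
  obtain ys where ys: "set ys = Y" using finite_list[OF Y(1)] by blast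
  define c where "c x = (LEAST k. k < length ys \<and> x \<in> V (ys ! k))" for x
  have c: "c x < length ys \<and> x \<in> V (ys ! c x)" for x
  proof -
    obtain y where "y \<in> set ys" "x \<in> V y" using Y(2) ys by blast
    then have "\<exists>k. k < length ys \<and> x \<in> V (ys ! k)" by (auto simp: in_set_conv_nth)
    then show ?thesis unfolding c_def by (rule LeastI_ex)
  qed
  show ?thesis
  proof
    have [measurable]: "V y \<in> sets borel" for y using openV by (rule borel_open)
    show "c \<in> borel \<rightarrow>\<^sub>M count_space UNIV"
      unfolding c_def by measurable
    show "c x < length ys" for x using c by blast
    show "c (x + s) \<noteq> c x" if "s \<in> S" for x s
    proof
      assume eq: "c (x + s) = c x"
      have "x + s + ys ! c x \<in> U" "x + ys ! c x \<in> U"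
        using c[of x] c[of "x + s"] eq by (auto simp: V_def)
      from U(3)[OF this] that show False by (simp add: algebra_simps)
    qed
  qed
qed

text \<open>The set built in the proof is a local rule: rank the colours by a random permutation and
  put \<open>x\<close> into the set if the lowest ranked point of \<open>x - F\<close> lies in \<open>x - I\<close>. Two points of the
  set that differ by an element of \<open>D\<close> see the same lowest ranked point, so the set is avoiding,
  and each point belongs to it with probability \<open>card I / card F\<close>.\<close>

lemma motzkin_density_lower:
  fixes I F :: "'a set"
  assumes F: "finite F" "I \<subseteq> F" and I: "avoiding D I"
    and nbr: "\<And>i d. i \<in> I \<Longrightarrow> d \<in> D \<Longrightarrow> i + d \<in> F \<and> i - d \<in> F"
  shows "real (card I) \<le> real (card F) * motzkin_density \<mu> D"
proof -
  \<comment> \<open>With this \<open>S\<close> the points \<open>x - f\<close> for distinct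
    \<open>f\<close> in \<open>F\<close> get distinct colours, so every permutation of the colours
    ranks them strictly.\<close>
  define S where "S = (\<lambda>(f, f'). f - f') ` (F \<times> F) - {0}"
  have "finite S" "0 \<notin> S" using F by (auto simp: S_def)
  then obtain m and c :: "'a \<Rightarrow> nat" where c [measurable]: "c \<in> borel \<rightarrow>\<^sub>M count_space UNIV"
    and cm: "\<And>x. c x < m" and cS: "\<And>x s. s \<in> S \<Longrightarrow> c (x + s) \<noteq> c x"
    by (metis finite_borel_coloring)
  have inj: "inj_on (\<lambda>f. c (x - f)) F" for x
  proof (rule inj_onI, rule ccontr)
    fix f f' assume f: "f \<in> F" "f' \<in> F" "c (x - f) = c (x - f')" "f \<noteq> f'"
    then have "f - f' \<in> S" by (force simp: S_def)
    from cS[OF this, of "x - f"] f(3) show False by (simp add: algebra_simps)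
  qed
  define A where "A \<sigma> = {x. \<exists>i\<in>I. \<forall>f\<in>F. \<sigma> (c (x - i)) \<le> (\<sigma> (c (x - f)) :: nat)}" for \<sigma>
  define P where "P = {\<sigma>. \<sigma> permutes {..<m}}"
  have finP: "finite P" by (simp add: P_def finite_permutations)
  have finI: "finite I" using F finite_subset by blast
  have borelA: "A \<sigma> \<in> sets borel" for \<sigma>
  proof -
    have [measurable]: "(\<lambda>x. \<sigma> (c (x - i))) \<in> borel \<rightarrow>\<^sub>M count_space UNIV" for i
    proof -
      have "\<sigma> \<circ> (c \<circ> (\<lambda>x. x - i)) \<in> borel \<rightarrow>\<^sub>M count_space UNIV"
        by (rule measurable_comp[OF measurable_comp[OF borel_translation_minus c]]) simp
      then show ?thesis by (simp add: o_def)
    qed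
    have "{x. \<sigma> (c (x - i)) \<le> \<sigma> (c (x - f))} \<in> sets borel" for i f
    proof -
      have "{x. \<sigma> (c (x - i)) \<le> \<sigma> (c (x - f))} =
        (\<Union>k. {x. \<sigma> (c (x - i)) = k} - (\<Union>l<k. {x. \<sigma> (c (x - f)) = l}))"
        by (auto simp: not_less)
      then show ?thesis by simp
    qed
    then have "(\<Union>i\<in>I. UNIV \<inter> (\<Inter>f\<in>F. {x. \<sigma> (c (x - i)) \<le> \<sigma> (c (x - f))})) \<in> sets borel"
      using F(1) finI by (cases "F = {}") (auto intro!: sets.finite_UN sets.finite_INT)
    also have "(\<Union>i\<in>I. UNIV \<inter> (\<Inter>f\<in>F. {x. \<sigma> (c (x - i)) \<le> \<sigma> (c (x - f))})) = A \<sigma>"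
      by (auto simp: A_def)
    finally show ?thesis .
  qed
  have avoidA: "avoiding D (A \<sigma>)" if "\<sigma> \<in> P" for \<sigma>
    unfolding avoiding_def
  proof (intro ballI notI)
    fix x y assume xy: "x \<in> A \<sigma>" "y \<in> A \<sigma>" "x - y \<in> D"
    then obtain i j where i: "i \<in> I" "\<And>f. f \<in> F \<Longrightarrow> \<sigma> (c (x - i)) \<le> \<sigma> (c (x - f))"
      and j: "j \<in> I" "\<And>f. f \<in> F \<Longrightarrow> \<sigma> (c (y - j)) \<le> \<sigma> (c (y - f))"
      by (auto simp: A_def)
    \<comment> \<open>The hypothesis on neighbours puts the lowest point \<open>y - j\<close> of
      \<open>y - F\<close> into \<open>x - F\<close>, and the lowest point \<open>x - i\<close> of
      \<open>x - F\<close> into \<open>y - F\<close>. Each is thus ranked at most as high as the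
      other, so they coincide and \<open>i - j = x - y\<close>, which contradicts that
      \<open>I\<close> is avoiding.\<close>
    have 1: "j + (x - y) \<in> F" "i - (x - y) \<in> F" using nbr i j xy(3) by auto
    have 2: "x - (j + (x - y)) = y - j" "y - (i - (x - y)) = x - i" by (simp_all add: algebra_simps)
    have "\<sigma> (c (x - i)) = \<sigma> (c (y - j))"
      using i(2)[OF 1(1)] j(2)[OF 1(2)] 2 by simp
    then have "c (x - i) = c (x - (j + (x - y)))"
      using that 2 permutes_inj[of \<sigma> "{..<m}"] by (simp add: P_def inj_eq)
    then have "i = j + (x - y)"
      using inj_onD[OF inj[of x]] i(1) F(2) 1(1) by blast
    then have "i - j \<in> D" using xy(3) by simp
    then show False using I i(1) j(1) by (auto simp: avoiding_def)
  qed
  \<comment> \<open>For fixed \<open>x\<close>, each \<open>i\<close> in \<open>I\<close> is the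
    winner for \<open>fact m / card F\<close> permutations, and different \<open>i\<close> win for
    disjoint sets of permutations.\<close>
  have count: "real (card I) * fact m / real (card F) \<le> real (card {\<sigma>\<in>P. x \<in> A \<sigma>})" for x
  proof -
    define N where "N i = {\<sigma>\<in>P. \<forall>f\<in>F. \<sigma> (c (x - i)) \<le> \<sigma> (c (x - f))}" for i
    have finN: "finite (N i)" for i using finP by (simp add: N_def)
    have cardN: "real (card (N i)) = fact m / real (card F)" if "i \<in> I" for i
    proof -
      have "card F * card (N i) = fact m"
        using card_permutations_least_at[of "(\<lambda>f. c (x - f)) ` F" m "c (x - i)"] that F(2) cm
        by (auto simp: card_image[OF inj] N_def P_def)
      then have "real (card F) * real (card (N i)) = fact m"
        by (metis of_nat_fact of_nat_mult)
      moreover have "real (card F) \<noteq> 0" using that F by auto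
      ultimately show ?thesis by (simp add: field_simps)
    qed
    have "card (\<Union>i\<in>I. N i) = (\<Sum>i\<in>I. card (N i))"
    proof (rule card_UN_disjoint[OF finI])
      show "\<forall>i\<in>I. finite (N i)" using finN by blast
      show "\<forall>i\<in>I. \<forall>j\<in>I. i \<noteq> j \<longrightarrow> N i \<inter> N j = {}"
      proof (intro ballI impI, rule ccontr)
        fix i j assume ij: "i \<in> I" "j \<in> I" "i \<noteq> j" "N i \<inter> N j \<noteq> {}"
        then obtain \<sigma> where "\<sigma> \<in> N i" "\<sigma> \<in> N j" by blast
        then have s: "\<sigma> permutes {..<m}" "\<sigma> (c (x - i)) = \<sigma> (c (x - j))"
          using ij F(2) by (auto simp: N_def P_def intro!: antisym)
        then have "c (x - i) = c (x - j)" using permutes_inj[of \<sigma>] by (simp add: inj_eq)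
        then show False using inj[of x] ij F(2) by (auto simp: inj_on_def)
      qed
    qed
    moreover have "(\<Union>i\<in>I. N i) = {\<sigma>\<in>P. x \<in> A \<sigma>}" by (auto simp: N_def A_def)
    ultimately have "real (card {\<sigma>\<in>P. x \<in> A \<sigma>}) = (\<Sum>i\<in>I. real (card (N i)))" by simp
    also have "\<dots> = real (card I) * fact m / real (card F)" using cardN by simp
    finally show ?thesis by simp
  qed
  have "real (card I) * fact m / real (card F) \<le> (\<Sum>\<sigma>\<in>P. measure \<mu> (A \<sigma>))"
    by (rule sum_measure_ge[OF finP borelA count])
  also have "\<dots> \<le> (\<Sum>\<sigma>\<in>P. motzkin_density \<mu> D)"
    by (intro sum_mono measure_le_motzkin_density borelA avoidA)
  also have "\<dots> = fact m * motzkin_density \<mu> D"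
    by (simp add: P_def card_permutations[OF refl])
  finally have *: "fact m * (real (card I) / real (card F)) \<le> fact m * motzkin_density \<mu> D"
    by (simp add: mult.commute)
  have "(0::real) < fact m" by simp
  with * have "real (card I) / real (card F) \<le> motzkin_density \<mu> D"
    by (rule mult_left_le_imp_le)
  \<comment> \<open>If \<open>F\<close> is empty, the quotient has the default value 0 and carries
    no information; this inequality settles that case.\<close>
  moreover have "card I \<le> card F" using F card_mono by blast
  ultimately show ?thesis by (cases "card F = 0") (auto simp: field_simps)
qed

end

section \<open>Relations of rank at most one\<close>

text \<open>Since \<open>nat\<close> sends negative integers to 0, at most one of the two sums is
  nonempty.\<close>

definition zmul :: "int \<Rightarrow> 'a::ab_group_add \<Rightarrow> 'a" where
  "zmul k x = (\<Sum>i<nat k. x) - (\<Sum>i<nat (- k). x)"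

lemma zmul_0 [simp]: "zmul 0 x = 0"
  by (simp add: zmul_def)

lemma zmul_Suc: "zmul (k + 1) x = zmul k x + x"
proof (cases "0 \<le> k")
  case True
  then show ?thesis by (simp add: zmul_def nat_add_distrib)
next
  case False
  then have "nat (- k) = Suc (nat (- (k + 1)))" by simp
  then show ?thesis using False by (simp add: zmul_def)
qed

lemma zmul_1 [simp]: "zmul 1 x = x"
  using zmul_Suc[of 0 x] by simp

lemma zmul_add_left: "zmul (a + b) x = zmul a x + zmul b x"
proof (induction b rule: int_induct[where k = 0])
  case (step1 i)
  then show ?case using zmul_Suc[of "a + i" x] zmul_Suc[of i x] by (simp add: algebra_simps)
next
  case (step2 i)
  then show ?case using zmul_Suc[of "a + (i - 1)" x] zmul_Suc[of "i - 1" x] by (simp add: algebra_simps)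
qed simp

lemma zmul_minus_left: "zmul (- a) x = - zmul a x"
  using zmul_add_left[of a "- a" x] by (simp add: eq_neg_iff_add_eq_0 add.commute)

lemma zmul_diff_left: "zmul (a - b) x = zmul a x - zmul b x"
  using zmul_add_left[of a "- b" x] by (simp add: zmul_minus_left)

lemma zmul_add_right: "zmul a (x + y) = zmul a x + zmul a y"
  by (simp add: zmul_def sum.distrib)

lemma zmul_zero_right [simp]: "zmul a 0 = 0"
  by (simp add: zmul_def)

lemma zmul_zmul: "zmul a (zmul b x) = zmul (a * b) x"
proof (induction a rule: int_induct[where k = 0])
  case (step1 i)
  then show ?case by (simp add: zmul_Suc zmul_add_left algebra_simps)
next
  case (step2 i)
  then show ?case by (simp add: zmul_diff_left algebra_simps)
qed simp

text \<open>The difference set \<open>A - A\<close> is symmetric, so forbidding \<open>d\<close> and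
  forbidding \<open>- d\<close> amount to the same. This later allows a relation to be given
  nonnegative coefficients.\<close>

lemma avoiding_cong_sign:
  assumes "\<And>d. d \<in> D \<Longrightarrow> d \<in> E \<or> - d \<in> E" "\<And>d. d \<in> E \<Longrightarrow> d \<in> D \<or> - d \<in> D"
  shows "avoiding D = avoiding E"
proof (rule ext)
  fix A :: "'a set"
  have "avoiding D' A" if "avoiding E' A" "\<And>d. d \<in> D' \<Longrightarrow> d \<in> E' \<or> - d \<in> E'" for D' E'
    using that unfolding avoiding_def by (metis minus_diff_eq)
  then show "avoiding D A = avoiding E A" using assms by metis
qed

text \<open>If \<open>x < h\<close>, then \<open>f\<close> would grow at least geometrically with
  ratio \<open>h / x > 1\<close> and outgrow the cubic bound. Applied to the sizes of images of
  cubes, this removes the loss between a window and its enlargement.\<close>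

lemma ratio_le_of_cubic_growth:
  fixes f :: "nat \<Rightarrow> real"
  assumes "f 0 \<ge> 1" and poly: "\<And>N. f N \<le> (2 * real N + 1) ^ 3"
    and step: "\<And>N. h * f N \<le> x * f (Suc N)" and "0 \<le> x"
  shows "h \<le> x"
proof (rule ccontr)
  assume "\<not> h \<le> x"
  then have h: "x < h" by simp
  have "x \<noteq> 0"
  proof
    assume "x = 0"
    then have "h * f 0 \<le> 0" using step[of 0] by simp
    then show False using h \<open>x = 0\<close> assms(1) by (simp add: mult_le_0_iff)
  qed
  with assms have x: "0 < x" by simp
  define r where "r = h / x"
  have r: "1 < r" using h x by (simp add: r_def)
  have "r ^ N \<le> f N" for N
  proof (induction N)
    case (Suc N)
    have "r ^ Suc N \<le> r * f N" using Suc r by simp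
    also have "\<dots> \<le> f (Suc N)" using step[of N] x by (simp add: r_def field_simps)
    finally show ?case .
  qed (use assms in simp)
  then have le: "1 \<le> (2 * real N + 1) ^ 3 / r ^ N" for N
    using poly[of N] r order_trans[OF _ poly[of N]] by simp
  have "(\<lambda>N. (2 * real N + 1) ^ 3 / r ^ N) \<longlonglongrightarrow> 0"
    using r by real_asymp
  from LIMSEQ_le_const[OF this, of 1] le show False by auto
qed

section \<open>Closed walks and colourings by residues\<close>

context haar_group
begin

text \<open>Along a closed walk of \<open>n\<close> steps, the cyclic successor of a position in
  \<open>A\<close> is never in \<open>A\<close>. So the positions in \<open>A\<close> and their
  successors are disjoint sets of equal size.\<close>

lemma motzkin_density_le_cycle:
  fixes s :: "nat \<Rightarrow> 'a"
  assumes "0 < n" "s n = s 0"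
    and "\<And>j. j < n \<Longrightarrow> s (Suc j) - s j \<in> D \<or> s j - s (Suc j) \<in> D"
  shows "real n * motzkin_density \<mu> D \<le> real (n div 2)"
proof -
  have "real (card {j\<in>{..<n}. s j \<in> A}) \<le> real (n div 2)" if A: "avoiding D A" for A
  proof -
    define X where "X = {j\<in>{..<n}. s j \<in> A}"
    define g where "g j = (if Suc j = n then 0 else Suc j)" for j
    have sg: "s (g j) = s (Suc j)" for j using assms(2) by (simp add: g_def)
    have fin: "finite X" by (simp add: X_def)
    have "inj_on g X" by (auto simp: inj_on_def g_def split: if_splits)
    then have "card (g ` X) = card X" by (rule card_image)
    moreover have "g ` X \<inter> X = {}"
    proof -
      have "s (g j) \<notin> A" if "j \<in> X" for j
        using that A assms(3)[of j] sg[of j] by (auto simp: X_def avoiding_def)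
      then show ?thesis by (auto simp: X_def)
    qed
    ultimately have "2 * card X = card (g ` X \<union> X)" using fin by (simp add: card_Un_disjoint)
    also have "\<dots> \<le> card {..<n}"
      by (rule card_mono) (auto simp: X_def g_def)
    finally show ?thesis by (simp add: X_def)
  qed
  from motzkin_density_upper[of "{..<n}" D s, OF _ this] show ?thesis by simp
qed

text \<open>By \<open>rel\<close> the coordinate sum modulo \<open>n\<close> is well defined on the
  generated group, and adding a generator raises it by one. Taking the even residues other than
  \<open>n - 1\<close> therefore gives an avoiding set; averaging over the \<open>n\<close> shifts
  of the residues makes it meet every finite window in a fair share.\<close>

lemma motzkin_density_ge_cyclic:
  fixes d1 d2 d3 :: 'a and n :: nat
  assumes rel: "\<And>a b c. zmul a d1 + zmul b d2 + zmul c d3 = 0 \<Longrightarrow> int n dvd a + b + c"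
    and "0 < n"
  shows "real (n div 2) \<le> real n * motzkin_density \<mu> {d1, d2, d3}"
proof -
  define lc where "lc a b c = zmul a d1 + zmul b d2 + zmul c d3" for a b c
  have lc_add: "lc a b c + lc a' b' c' = lc (a + a') (b + b') (c + c')" for a b c a' b' c'
    by (simp add: lc_def zmul_add_left)
  have lc_diff: "lc a b c - lc a' b' c' = lc (a - a') (b - b') (c - c')" for a b c a' b' c'
    by (simp add: lc_def zmul_diff_left)
  have lc_unit: "d1 = lc 1 0 0" "d2 = lc 0 1 0" "d3 = lc 0 0 1" by (simp_all add: lc_def)
  \<comment> \<open>The value depends on the chosen representation of \<open>x\<close>; only its
    residue modulo \<open>n\<close> is meaningful.\<close>
  define \<phi> where "\<phi> x = (SOME s. \<exists>a b c. x = lc a b c \<and> s = a + b + c)" for x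
  have \<phi>: "\<phi> (lc a b c) mod int n = (a + b + c) mod int n" for a b c
  proof -
    have "\<exists>a' b' c'. lc a b c = lc a' b' c' \<and> \<phi> (lc a b c) = a' + b' + c'"
      unfolding \<phi>_def by (rule someI) blast
    then obtain a' b' c' where *: "lc a b c = lc a' b' c'" "\<phi> (lc a b c) = a' + b' + c'" by blast
    then have "lc (a' - a) (b' - b) (c' - c) = 0" by (simp flip: lc_diff)
    then have "int n dvd (a' - a) + (b' - b) + (c' - c)" unfolding lc_def by (rule rel)
    then have "int n dvd \<phi> (lc a b c) - (a + b + c)" by (simp add: *(2) algebra_simps)
    then show ?thesis by (simp add: mod_eq_dvd_iff)
  qed
  define Q where "Q N = {- int N..int N} \<times> {- int N..int N} \<times> {- int N..int N}" for N
  define F where "F N = (\<lambda>(a, b, c). lc a b c) ` Q N" for N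
  have finF: "finite (F N)" for N by (simp add: F_def Q_def)
  have F_mono: "F N \<subseteq> F (Suc N)" for N
    unfolding F_def by (rule image_mono) (auto simp: Q_def)
  have step: "real (n div 2) * real (card (F N))
      \<le> (real n * motzkin_density \<mu> {d1, d2, d3}) * real (card (F (Suc N)))" for N
  proof -
    define r where "r k x = (\<phi> x + k) mod int n" for k x
    \<comment> \<open>The second condition drops the residue \<open>n - 1\<close>: for odd
      \<open>n\<close> it is even, and its successor is the even residue 0.\<close>
    define I where "I k = {x \<in> F N. even (r k x) \<and> r k x + 1 < int n}" for k
    have finI: "finite (I k)" for k using finF by (simp add: I_def)
    have I_le: "real (card (I k)) \<le> real (card (F (Suc N))) * motzkin_density \<mu> {d1, d2, d3}" for k
    proof (rule motzkin_density_lower[OF finF])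
      show "I k \<subseteq> F (Suc N)" using F_mono by (auto simp: I_def)
      show "avoiding {d1, d2, d3} (I k)"
        unfolding avoiding_def
      proof (intro ballI notI)
        fix x y assume xy: "x \<in> I k" "y \<in> I k" "x - y \<in> {d1, d2, d3}"
        then obtain a b c where y: "y = lc a b c" by (auto simp: I_def F_def)
        obtain d where d: "d \<in> {d1, d2, d3}" "x = y + d" using xy(3) by (metis add_diff_cancel_left' diff_add_cancel add.commute)
        obtain a' b' c' where x: "x = lc a' b' c'" "a' + b' + c' = a + b + c + 1"
        proof -
          from d(1) consider "d = lc 1 0 0" | "d = lc 0 1 0" | "d = lc 0 0 1" using lc_unit by blast
          then show ?thesis
            by cases (rule that, use d(2) y in \<open>simp add: lc_add\<close>, simp)+
        qed
        have "r k x = (a' + b' + c' + k) mod int n"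
          unfolding r_def x(1) by (rule mod_add_cong[OF \<phi> refl])
        also have "a' + b' + c' + k = (a + b + c + k) + 1" using x(2) by linarith
        also have "(a + b + c + k + 1) mod int n = (r k y + 1) mod int n"
          unfolding r_def y by (intro mod_add_cong refl) (metis \<phi> mod_add_cong mod_mod_trivial)
        also have "\<dots> = r k y + 1"
          using xy(2) assms(2) by (intro mod_pos_pos_trivial) (auto simp: I_def r_def intro: order.trans)
        finally show False using xy(1,2) by (simp add: I_def)
      qed
      fix x d assume x: "x \<in> I k" and d: "d \<in> {d1, d2, d3}"
      from x obtain a b c where abc: "x = lc a b c" "(a, b, c) \<in> Q N" by (auto simp: I_def F_def)
      have FI: "lc u v w \<in> F (Suc N)" if "(u, v, w) \<in> Q (Suc N)" for u v w
        using that by (force simp: F_def)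
      from d consider "d = lc 1 0 0" | "d = lc 0 1 0" | "d = lc 0 0 1" using lc_unit by blast
      then show "x + d \<in> F (Suc N) \<and> x - d \<in> F (Suc N)"
        by cases (use abc in \<open>auto simp: lc_add lc_diff Q_def intro!: FI\<close>)
    qed
    have count: "n div 2 \<le> card {k\<in>{0..<int n}. even (r k x) \<and> r k x + 1 < int n}" for x
    proof -
      \<comment> \<open>\<open>g j\<close> is the shift that moves the residue of \<open>x\<close>
        to \<open>2 * j\<close>, so at least \<open>n div 2\<close> of the shifts select
        \<open>x\<close>.\<close>
      define g where "g j = (2 * int j - \<phi> x) mod int n" for j
      have rg: "r (g j) x = 2 * int j" if "j < n div 2" for j
      proof -
        have "r (g j) x = (\<phi> x + (2 * int j - \<phi> x)) mod int n"
          unfolding r_def g_def by (rule mod_add_right_eq)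
        also have "\<dots> = 2 * int j" using that by simp
        finally show ?thesis .
      qed
      have "card {..<n div 2} \<le> card {k\<in>{0..<int n}. even (r k x) \<and> r k x + 1 < int n}"
      proof (rule card_inj_on_le[where f = g])
        show "inj_on g {..<n div 2}"
        proof (rule inj_onI)
          fix i j assume ij: "i \<in> {..<n div 2}" "j \<in> {..<n div 2}" "g i = g j"
          have "2 * int i = r (g i) x" using ij(1) by (intro rg[symmetric]) simp
          also have "\<dots> = 2 * int j" unfolding ij(3) using ij(2) by (intro rg) simp
          finally show "i = j" by simp
        qed
        show "g ` {..<n div 2} \<subseteq> {k\<in>{0..<int n}. even (r k x) \<and> r k x + 1 < int n}"
        proof clarify
          fix j assume "j < n div 2"
          moreover have "0 \<le> g j" "g j < int n" using assms(2) by (simp_all add: g_def)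
          ultimately show "g j \<in> {0..<int n} \<and> even (r (g j) x) \<and> r (g j) x + 1 < int n"
            by (auto simp: rg)
        qed
        show "finite {k\<in>{0..<int n}. even (r k x) \<and> r k x + 1 < int n}"
          by (rule finite_subset[of _ "{0..<int n}"]) auto
      qed
      then show ?thesis by simp
    qed
    have "real (n div 2) * real (card (F N)) = (\<Sum>x\<in>F N. real (n div 2))" by simp
    also have "\<dots> \<le> (\<Sum>x\<in>F N. real (card {k\<in>{0..<int n}. even (r k x) \<and> r k x + 1 < int n}))"
      using count by (intro sum_mono) simp
    also have "\<dots> = (\<Sum>k\<in>{0..<int n}. real (card (I k)))"
    proof -
      have "(\<Sum>x\<in>F N. card {k\<in>{0..<int n}. even (r k x) \<and> r k x + 1 < int n})
          = (\<Sum>k\<in>{0..<int n}. card (I k))"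
        unfolding I_def by (rule sum_multicount_gen) (use finF in auto)
      then show ?thesis by (simp flip: of_nat_sum)
    qed
    also have "\<dots> \<le> (\<Sum>k\<in>{0..<int n}. real (card (F (Suc N))) * motzkin_density \<mu> {d1, d2, d3})"
      by (intro sum_mono I_le)
    finally show ?thesis by (simp add: mult_ac)
  qed
  show ?thesis
  proof (rule ratio_le_of_cubic_growth[where f = "\<lambda>N. real (card (F N))"])
    show "1 \<le> real (card (F 0))" by (simp add: F_def Q_def)
    show "real (card (F N)) \<le> (2 * real N + 1) ^ 3" for N
    proof -
      have "card (F N) \<le> card (Q N)" unfolding F_def by (rule card_image_le) (simp add: Q_def)
      also have "\<dots> = (2 * N + 1) ^ 3"
      proof -
        have "nat (1 + int N + int N) = 2 * N + 1" by simp
        then show ?thesis by (simp add: Q_def card_cartesian_product power3_eq_cube)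
      qed
      finally have "real (card (F N)) \<le> real ((2 * N + 1) ^ 3)" by (simp only: of_nat_le_iff)
      then show ?thesis by (simp add: add.commute)
    qed
  qed (use step motzkin_density_nonneg in auto)
qed

lemma motzkin_density_rational_bipartite:
  fixes d1 d2 d3 :: 'a
  assumes "\<And>a b c. zmul a d1 + zmul b d2 + zmul c d3 = 0 \<Longrightarrow> even (a + b + c)"
  shows "motzkin_density \<mu> {d1, d2, d3} \<in> \<rat>"
proof -
  have "real (2 div 2) \<le> real 2 * motzkin_density \<mu> {d1, d2, d3}"
    by (rule motzkin_density_ge_cyclic) (use assms in auto)
  \<comment> \<open>The edge between \<open>0\<close> and \<open>d1\<close>, traversed back and
    forth, is a closed walk of length two.\<close>
  moreover have "real 2 * motzkin_density \<mu> {d1, d2, d3} \<le> real (2 div 2)"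
    by (rule motzkin_density_le_cycle[where s = "\<lambda>j. if j = 1 then d1 else 0"]) (auto simp: less_2_cases_iff)
  ultimately have "motzkin_density \<mu> {d1, d2, d3} = 1 / 2" by simp
  moreover have "(1 / 2 :: real) \<in> \<rat>" by simp
  ultimately show ?thesis by (simp only:)
qed

text \<open>Let \<open>n\<close> be the least odd coordinate sum of a nonnegative relation. That
  relation is a closed walk of \<open>n\<close> steps, which bounds the density from above. As all
  relations are parallel, \<open>n\<close> divides every coordinate sum, so the residue colouring
  gives the matching lower bound.\<close>

lemma motzkin_density_rational_odd_cycle:
  fixes d1 d2 d3 :: 'a
  defines "rel \<equiv> \<lambda>a b c. zmul a d1 + zmul b d2 + zmul c d3 = 0"
  assumes par: "\<And>a b c x y z. rel a b c \<Longrightarrow> rel x y z \<Longrightarrow> a * y = x * b \<and> a * z = x * c \<and> b * z = y * c"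
    and ex: "rel a b c" "0 \<le> a" "0 \<le> b" "0 \<le> c" "odd (a + b + c)"
  shows "motzkin_density \<mu> {d1, d2, d3} \<in> \<rat>"
proof -
  define good where "good n \<longleftrightarrow> (\<exists>a b c. rel a b c \<and> 0 \<le> a \<and> 0 \<le> b \<and> 0 \<le> c \<and>
    a + b + c = int n \<and> odd n)" for n
  have rel_diff: "rel (x - u) (y - v) (z - w)" if "rel x y z" "rel u v w" for x y z u v w
  proof -
    have "zmul (x - u) d1 + zmul (y - v) d2 + zmul (z - w) d3 =
      (zmul x d1 + zmul y d2 + zmul z d3) - (zmul u d1 + zmul v d2 + zmul w d3)"
      by (simp add: zmul_diff_left)
    then show ?thesis using that by (simp add: rel_def)
  qed
  have rel_mult: "rel (k * x) (k * y) (k * z)" if "rel x y z" for k x y z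
  proof -
    have "zmul (k * x) d1 + zmul (k * y) d2 + zmul (k * z) d3 = zmul k (zmul x d1 + zmul y d2 + zmul z d3)"
      by (simp add: zmul_add_right zmul_zmul)
    then show ?thesis using that by (simp add: rel_def)
  qed
  have "good (nat (a + b + c))"
    unfolding good_def using ex by (intro exI[of _ a] exI[of _ b] exI[of _ c]) (auto simp: even_nat_iff)
  define n where "n = (LEAST n. good n)"
  have "good n" unfolding n_def by (rule LeastI) fact
  have n_le: "n \<le> m" if "good m" for m unfolding n_def using that by (rule Least_le)
  from \<open>good n\<close> obtain a b c where abc: "rel a b c" "0 \<le> a" "0 \<le> b" "0 \<le> c"
    and n: "a + b + c = int n" "odd n" by (auto simp: good_def)
  then have npos: "0 < n" by (cases n) auto
  have dvd: "int n dvd x + y + z" if xyz: "rel x y z" for x y z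
  proof (rule ccontr)
    assume nd: "\<not> int n dvd x + y + z"
    define s where "s = (x + y + z) mod int n"
    define q where "q = (x + y + z) div int n"
    have s: "0 < s" "s < int n"
    proof -
      have "s \<noteq> 0" using nd unfolding s_def dvd_eq_mod_eq_0 .
      moreover have "0 \<le> s" "s < int n" using npos by (simp_all add: s_def)
      ultimately show "0 < s" "s < int n" by simp_all
    qed
    \<comment> \<open>Subtracting \<open>q\<close> copies of the minimal relation leaves a relation
      with coordinate sum \<open>s\<close>, strictly between 0 and \<open>n\<close>.\<close>
    define x' y' z' where "x' = x - q * a" and "y' = y - q * b" and "z' = z - q * c"
    have rel': "rel x' y' z'" unfolding x'_def y'_def z'_def
      by (intro rel_diff rel_mult xyz abc)
    have sum: "x' + y' + z' = s"
    proof -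
      have "x' + y' + z' = (x + y + z) - q * (a + b + c)"
        by (simp add: x'_def y'_def z'_def algebra_simps)
      then show ?thesis by (simp add: n s_def q_def minus_div_mult_eq_mod)
    qed
    text \<open>By parallelism the relation reduced modulo \<open>(a, b, c)\<close> is the fraction \<open>s / n\<close> of it,
      so both it and its complement in \<open>(a, b, c)\<close> are shorter nonnegative relations,
      and one of the two is odd.\<close>
    have n': "int n * x' = s * a" "int n * y' = s * b" "int n * z' = s * c"
      using par[OF abc(1) rel'] by (simp_all add: algebra_simps flip: sum n(1))
    have "0 \<le> int n * x'" "0 \<le> int n * y'" "0 \<le> int n * z'"
      unfolding n' using s abc by simp_all
    then have pos: "0 \<le> x'" "0 \<le> y'" "0 \<le> z'" using npos by (simp_all add: zero_le_mult_iff)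
    have "int n * (a - x') = (int n - s) * a" "int n * (b - y') = (int n - s) * b"
      "int n * (c - z') = (int n - s) * c" using n' by (simp_all add: algebra_simps)
    moreover have "0 \<le> (int n - s) * a" "0 \<le> (int n - s) * b" "0 \<le> (int n - s) * c"
      using s abc by simp_all
    ultimately have pos': "0 \<le> a - x'" "0 \<le> b - y'" "0 \<le> c - z'"
      using npos by (metis of_nat_0_less_iff zero_le_mult_iff not_less)+
    show False
    proof (cases "even s")
      case True
      have "good (nat (int n - s))"
        unfolding good_def using rel_diff[OF abc(1) rel'] pos' True s sum n
        by (intro exI[of _ "a - x'"] exI[of _ "b - y'"] exI[of _ "c - z'"]) (auto simp: even_nat_iff)
      then show False using n_le s by fastforce
    next
      case False
      have "good (nat s)"
        unfolding good_def using rel' pos False s sum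
        by (intro exI[of _ "x'"] exI[of _ "y'"] exI[of _ "z'"]) (auto simp: even_nat_iff)
      then show False using n_le s by fastforce
    qed
  qed
  have lower: "real (n div 2) \<le> real n * motzkin_density \<mu> {d1, d2, d3}"
    by (rule motzkin_density_ge_cyclic[OF _ npos]) (use dvd in \<open>simp add: rel_def\<close>)
  \<comment> \<open>The walk takes \<open>a\<close> steps \<open>d1\<close>, then \<open>b\<close>
    steps \<open>d2\<close>, then \<open>c\<close> steps \<open>d3\<close>; \<open>min\<close> and
    \<open>max\<close> clip the three phases.\<close>
  define p where "p j = zmul (min j a) d1 + zmul (max 0 (min (j - a) b)) d2 + zmul (max 0 (j - a - b)) d3" for j
  have upper: "real n * motzkin_density \<mu> {d1, d2, d3} \<le> real (n div 2)"
  proof (rule motzkin_density_le_cycle[where s = "\<lambda>j. p (int j)"])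
    have "p (int n) = zmul a d1 + zmul b d2 + zmul c d3" "p 0 = 0"
      using abc n(1)[symmetric] by (simp_all add: p_def)
    then show "p (int n) = p (int 0)" using abc(1) by (simp add: rel_def)
    fix j
    have "p (int j + 1) - p (int j) \<in> {d1, d2, d3}"
    proof -
      consider "int j < a" | "a \<le> int j" "int j < a + b" | "a + b \<le> int j" by linarith
      then show ?thesis
      proof cases
        case 1
        then show ?thesis using abc by (simp add: p_def min_absorb1 max_absorb1 zmul_Suc)
      next
        case 2
        then have "p (int j + 1) = zmul a d1 + zmul ((int j - a) + 1) d2" "p (int j) = zmul a d1 + zmul (int j - a) d2"
          using abc by (simp_all add: p_def min_absorb1 min_absorb2 max_absorb1 max_absorb2 algebra_simps)
        then show ?thesis by (simp add: zmul_Suc)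
      next
        case 3
        then have "p (int j + 1) = zmul a d1 + zmul b d2 + zmul ((int j - a - b) + 1) d3"
          "p (int j) = zmul a d1 + zmul b d2 + zmul (int j - a - b) d3"
          using abc by (simp_all add: p_def min_absorb2 max_absorb2 algebra_simps)
        then show ?thesis by (simp add: zmul_Suc)
      qed
    qed
    then show "p (int (Suc j)) - p (int j) \<in> {d1, d2, d3} \<or> p (int j) - p (int (Suc j)) \<in> {d1, d2, d3}"
      by (simp add: add.commute)
  qed (rule npos)
  have "motzkin_density \<mu> {d1, d2, d3} = real (n div 2) / real n"
    using lower upper npos by (simp add: field_simps)
  moreover have "real (n div 2) / real n \<in> \<rat>" by simp
  ultimately show ?thesis by (simp only:)
qed

end

section \<open>Relations of rank at least two\<close>

lemma sum_lessThan_add: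
  fixes f :: "nat \<Rightarrow> 'a::comm_monoid_add"
  shows "(\<Sum>i<a + b. f i) = (\<Sum>i<a. f i) + (\<Sum>i<b. f (a + i))"
  by (induction b) (simp_all add: add.assoc)

text \<open>Here \<open>\<rho>\<close> is the largest mean weight of a closed walk of length at most
  \<open>card V\<close>; repeating an optimal one gives \<open>s\<close>. Any walk loses such closed
  walks one by one until fewer than \<open>card V\<close> steps are left, whose weight goes into
  \<open>c\<close>. The loop at \<open>v\<close> guarantees that a closed walk exists.\<close>

lemma finite_graph_max_mean_walk:
  fixes V :: "'v set" and E :: "'v \<Rightarrow> 'v \<Rightarrow> bool" and w :: "'v \<Rightarrow> nat"
  assumes V: "finite V" and v: "v \<in> V" "E v v"
  obtains \<rho> c :: real and l :: nat and s
  where "\<rho> \<in> \<rat>" "0 < l"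
    and "\<And>i. s i \<in> V" "\<And>i. E (s i) (s (Suc i))"
    and "\<And>q. real (\<Sum>i<q * l. w (s i)) = \<rho> * real (q * l)"
    and "\<forall>N r. (\<forall>i\<le>N. r i \<in> V) \<and> (\<forall>i<N. E (r i) (r (Suc i))) \<longrightarrow>
      real (\<Sum>i<N. w (r i)) \<le> \<rho> * real N + c"
proof -
  define walk where "walk r N \<longleftrightarrow> (\<forall>i\<le>N. r i \<in> V) \<and> (\<forall>i<N. E (r i) (r (Suc i)))" for r :: "nat \<Rightarrow> 'v" and N
  define W where "W = Max (w ` V)"
  have W: "w x \<le> W" if "x \<in> V" for x using V that by (simp add: W_def)
  have walk_le: "(\<Sum>i<N. w (r i)) \<le> N * W" if "walk r N" for r N
    using sum_bounded_above[of "{..<N}" "\<lambda>i. w (r i)" W] that W by (simp add: walk_def)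
  define R where "R = {real (\<Sum>i<l. w (r i)) / real l | r l. 0 < l \<and> l \<le> card V \<and> walk r l \<and> r l = r 0}"
  have cV: "0 < card V" using V v by (auto simp: card_gt_0_iff)
  \<comment> \<open>The means are quotients of bounded natural numbers, so there are finitely many
    and the maximum is attained.\<close>
  have "R \<subseteq> (\<lambda>(a, b). real a / real b) ` ({..card V * W} \<times> {..card V})"
  proof
    fix x assume "x \<in> R"
    then obtain r l where rl: "l \<le> card V" "walk r l" "x = real (\<Sum>i<l. w (r i)) / real l"
      by (auto simp: R_def)
    have "(\<Sum>i<l. w (r i)) \<le> card V * W"
      using walk_le[OF rl(2)] rl(1) by (meson le_trans mult_le_mono1)
    then show "x \<in> (\<lambda>(a, b). real a / real b) ` ({..card V * W} \<times> {..card V})"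
      using rl by (intro image_eqI[of _ _ "(\<Sum>i<l. w (r i), l)"]) auto
  qed
  then have finR: "finite R" by (rule finite_subset) simp
  have "real (\<Sum>i<1::nat. w v) / real 1 \<in> R"
    unfolding R_def mem_Collect_eq using v cV
    by (intro exI[of _ "\<lambda>_. v"] exI[of _ 1]) (auto simp: walk_def)
  then have neR: "R \<noteq> {}" by blast
  define \<rho> where "\<rho> = Max R"
  have "\<rho> \<in> R" unfolding \<rho>_def using finR neR by (rule Max_in)
  then obtain r l where l: "0 < l" "walk r l" "r l = r 0" and \<rho>: "\<rho> = real (\<Sum>i<l. w (r i)) / real l"
    by (auto simp: R_def)
  have \<rho>_pos: "0 \<le> \<rho>" by (simp add: \<rho> sum_nonneg)
  have \<rho>_rat: "\<rho> \<in> \<rat>" unfolding \<rho> by (intro Rats_divide Rats_of_nat)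
  define s where "s i = r (i mod l)" for i
  have sV: "s i \<in> V" for i using l by (simp add: s_def walk_def)
  have sE: "E (s i) (s (Suc i))" for i
  proof -
    have "s (Suc i) = r (Suc (i mod l))" using l(3) by (simp add: s_def mod_Suc)
    then show ?thesis using l(1,2) by (simp add: s_def walk_def)
  qed
  have "(\<Sum>i<q * l. w (s i)) = q * (\<Sum>i<l. w (r i))" for q
  proof (induction q)
    case (Suc q)
    have "(\<Sum>i<q * l + l. w (s i)) = (\<Sum>i<q * l. w (s i)) + (\<Sum>i<l. w (s (q * l + i)))"
      by (rule sum_lessThan_add)
    also have "(\<Sum>i<l. w (s (q * l + i))) = (\<Sum>i<l. w (r i))"
      by (intro sum.cong) (simp_all add: s_def)
    finally show ?case using Suc by (simp add: add.commute)
  qed simp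
  then have sw: "real (\<Sum>i<q * l. w (s i)) = \<rho> * real (q * l)" for q
    using l(1) by (simp add: \<rho>)
  have upper: "real (\<Sum>i<N. w (r i)) \<le> \<rho> * real N + real (card V * W)" if "walk r N" for r N
    using that
  proof (induction N arbitrary: r rule: less_induct)
    case (less N)
    show ?case
    proof (cases "N < card V")
      case True
      then have "(\<Sum>i<N. w (r i)) \<le> card V * W"
        using walk_le[OF less.prems] by (meson le_trans less_imp_le mult_le_mono1)
      then have "real (\<Sum>i<N. w (r i)) \<le> real (card V * W)" by (simp only: of_nat_le_iff)
      then show ?thesis using \<rho>_pos by (smt (verit) mult_nonneg_nonneg of_nat_0_le_iff)
    next
      case False
      have "\<not> inj_on r {..card V}"
      proof
        assume "inj_on r {..card V}"
        moreover have "r ` {..card V} \<subseteq> V" using less.prems False by (auto simp: walk_def)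
        ultimately have "card {..card V} \<le> card V" using V by (rule card_inj_on_le)
        then show False by simp
      qed
      then obtain i j where ij: "i < j" "j \<le> card V" "r i = r j"
        unfolding inj_on_def by (metis atMost_iff linorder_neqE_nat)
      define p where "p = j - i"
      define M where "M = N - j"
      have p: "0 < p" "j = i + p" "p \<le> card V" and N: "N = i + p + M"
        using ij False by (auto simp: p_def M_def)
      \<comment> \<open>\<open>u\<close> is the walk \<open>r\<close> with the closed piece between
        the equal vertices \<open>r i\<close> and \<open>r j\<close> cut out.\<close>
      define u where "u k = (if k < i then r k else r (k + p))" for k
      have "walk (\<lambda>k. r (i + k)) p" using less.prems N by (auto simp: walk_def)
      then have "real (\<Sum>k<p. w (r (i + k))) / real p \<in> R"
        unfolding R_def mem_Collect_eq using p ij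
        by (intro exI[of _ "\<lambda>k. r (i + k)"] exI[of _ p]) simp
      then have "real (\<Sum>k<p. w (r (i + k))) / real p \<le> \<rho>"
        unfolding \<rho>_def using finR by (rule Max_ge[rotated])
      then have cyc: "real (\<Sum>k<p. w (r (i + k))) \<le> \<rho> * real p" using p by (simp add: field_simps)
      have "walk u (i + M)"
        unfolding walk_def
      proof (intro conjI allI impI)
        fix k assume "k \<le> i + M"
        then show "u k \<in> V" using less.prems N by (auto simp: walk_def u_def)
      next
        fix k assume k: "k < i + M"
        have Er: "E (r k) (r (Suc k))" if "k < N" for k using less.prems that by (simp add: walk_def)
        consider "Suc k < i" | "Suc k = i" | "i \<le> k" by linarith
        then show "E (u k) (u (Suc k))"
        proof cases
          case 2
          then have "u (Suc k) = r (Suc k)" using ij(3) p(2) by (simp add: u_def)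
          then show ?thesis using 2 Er[of k] N p by (simp add: u_def)
        next
          case 3
          then show ?thesis using k Er[of "k + p"] N by (simp add: u_def)
        qed (use Er N in \<open>simp add: u_def\<close>)
      qed
      moreover have "i + M < N" using N p by simp
      ultimately have IH: "real (\<Sum>k<i + M. w (u k)) \<le> \<rho> * real (i + M) + real (card V * W)"
        using less.IH by blast
      have "(\<Sum>k<i + M. w (u k)) = (\<Sum>k<i. w (r k)) + (\<Sum>k<M. w (r (i + p + k)))"
        unfolding sum_lessThan_add by (intro arg_cong2[where f = "(+)"] sum.cong) (simp_all add: u_def add_ac)
      moreover have "(\<Sum>k<N. w (r k)) = (\<Sum>k<i. w (r k)) + (\<Sum>k<p. w (r (i + k))) + (\<Sum>k<M. w (r (i + p + k)))"
        by (simp add: sum_lessThan_add N)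
      ultimately have "(\<Sum>k<N. w (r k)) = (\<Sum>k<i + M. w (u k)) + (\<Sum>k<p. w (r (i + k)))" by simp
      then have "real (\<Sum>k<N. w (r k)) = real (\<Sum>k<i + M. w (u k)) + real (\<Sum>k<p. w (r (i + k)))"
        by (simp only: of_nat_add)
      also have "\<dots> \<le> \<rho> * real (i + M) + real (card V * W) + \<rho> * real p"
        using IH cyc by (rule add_mono)
      also have "\<dots> = \<rho> * real N + real (card V * W)" by (simp add: N algebra_simps)
      finally show ?thesis .
    qed
  qed
  show ?thesis
    by (rule that[OF \<rho>_rat l(1) sV sE sw]) (use upper in \<open>unfold walk_def, blast\<close>)
qed

lemma nonpos_of_bounded_multiples:
  fixes y c :: real
  assumes "\<And>N :: nat. real N * y \<le> c"
  shows "y \<le> 0"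
proof (rule ccontr)
  assume "\<not> y \<le> 0"
  then obtain N :: nat where "c < real N * y" using reals_Archimedean3[of y] by auto
  then show False using assms[of N] by simp
qed

section \<open>Finite and virtually cyclic groups\<close>

context haar_group
begin

text \<open>Since \<open>F\<close> is closed under the steps, it can serve as its own window, and
  the upper and lower bounds meet at the largest avoiding subset of \<open>F\<close>.\<close>

lemma motzkin_density_rational_finite:
  fixes F :: "'a set"
  assumes F: "finite F" "F \<noteq> {}" and nbr: "\<And>x d. x \<in> F \<Longrightarrow> d \<in> D \<union> uminus ` D \<Longrightarrow> x + d \<in> F"
  shows "motzkin_density \<mu> D \<in> \<rat>"
proof -
  define K where "K = card ` {I. I \<subseteq> F \<and> avoiding D I}"
  have "finite K" using F by (simp add: K_def)
  moreover have "card ({}::'a set) \<in> K" unfolding K_def by (rule imageI) (simp add: avoiding_def)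
  ultimately have "Max K \<in> K" using Max_in by blast
  then obtain I where I: "I \<subseteq> F" "avoiding D I" "card I = Max K" by (auto simp: K_def)
  have "real (card I) \<le> real (card F) * motzkin_density \<mu> D"
  proof (rule motzkin_density_lower[OF F(1) I(1,2)])
    fix i d assume "i \<in> I" "d \<in> D"
    then show "i + d \<in> F \<and> i - d \<in> F" using I(1) nbr[of i d] nbr[of i "- d"] by auto
  qed
  moreover have "real (card F) * motzkin_density \<mu> D \<le> real (card I)"
  proof (rule motzkin_density_upper[OF F(1), where s = "\<lambda>x. x"])
    fix A assume "avoiding D A"
    then have "card {j \<in> F. j \<in> A} \<in> K"
      unfolding K_def by (intro imageI) (auto simp: avoiding_def)
    then show "real (card {j \<in> F. j \<in> A}) \<le> real (card I)" using \<open>finite K\<close> I(3) by simp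
  qed
  moreover have "0 < card F" using F by (simp add: card_gt_0_iff)
  ultimately have "motzkin_density \<mu> D = real (card I) / real (card F)" by (simp add: field_simps)
  moreover have "real (card I) / real (card F) \<in> \<rat>" by simp
  ultimately show ?thesis by (simp only:)
qed

text \<open>A transfer matrix argument: the translates of \<open>B\<close> by multiples of
  \<open>T\<close> are disjoint and a step reaches at most an adjacent one. An avoiding set inside
  them is thus a walk on the subsets of \<open>B\<close> in which consecutive subsets are
  compatible, and \<open>card B\<close> times the density is the maximal mean size along such
  walks.\<close>

lemma motzkin_density_rational_blocks:
  fixes B :: "'a set" and T :: 'a
  assumes B: "finite B" "B \<noteq> {}"
    and inj: "\<And>b b' k k'. b \<in> B \<Longrightarrow> b' \<in> B \<Longrightarrow> b + zmul k T = b' + zmul k' T \<Longrightarrow> b = b' \<and> k = k'"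
    and nbr: "\<And>b d. b \<in> B \<Longrightarrow> d \<in> D \<union> uminus ` D \<Longrightarrow> \<exists>b'\<in>B. \<exists>k\<in>{-1, 0, 1}. b + d = b' + zmul k T"
  shows "motzkin_density \<mu> D \<in> \<rat>"
proof -
  \<comment> \<open>\<open>S\<close> and \<open>S'\<close> are the traces of a set on two
    consecutive blocks, each translated back to \<open>B\<close>.\<close>
  define E where "E S S' \<longleftrightarrow> avoiding D (S \<union> (\<lambda>x. x + T) ` S')" for S S'
  have "finite (Pow B)" "{} \<in> Pow B" "E {} {}" using B by (auto simp: E_def avoiding_def)
  then obtain \<rho> c l s where \<rho>: "\<rho> \<in> \<rat>" "0 < l"
    and sB: "\<And>i. s i \<in> Pow B" and sE: "\<And>i. E (s i) (s (Suc i))"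
    and sw: "\<And>q. real (\<Sum>i<q * l. card (s i)) = \<rho> * real (q * l)"
    and max: "\<forall>N r. (\<forall>i\<le>N. r i \<in> Pow B) \<and> (\<forall>i<N. E (r i) (r (Suc i))) \<longrightarrow>
      real (\<Sum>i<N. card (r i)) \<le> \<rho> * real N + c"
    by (rule finite_graph_max_mean_walk[where w = card and E = E and V = "Pow B" and v = "{}"]) (rule that)
  define X where "X = real (card B) * motzkin_density \<mu> D"
  have upper: "real N * X \<le> \<rho> * real N + c" for N
  proof -
    have "real (card ({..<N} \<times> B)) * motzkin_density \<mu> D \<le> \<rho> * real N + c"
    proof (rule motzkin_density_upper[where s = "\<lambda>(k, b). b + zmul (int k) T"])
      fix A assume A: "avoiding D A"
      define r where "r k = {b \<in> B. b + zmul (int k) T \<in> A}" for k :: nat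
      have "{j \<in> {..<N} \<times> B. (case j of (k, b) \<Rightarrow> b + zmul (int k) T) \<in> A} = (SIGMA k:{..<N}. r k)"
        by (auto simp: r_def)
      moreover have "card (SIGMA k:{..<N}. r k) = (\<Sum>k<N. card (r k))"
        using B by (intro card_SigmaI) (auto simp: r_def)
      moreover have "real (\<Sum>k<N. card (r k)) \<le> \<rho> * real N + c"
      proof (rule max[rule_format], intro conjI allI impI)
        fix k
        show "E (r k) (r (Suc k))"
          unfolding E_def avoiding_def
        proof (intro ballI)
          fix x y assume xy: "x \<in> r k \<union> (\<lambda>x. x + T) ` r (Suc k)" "y \<in> r k \<union> (\<lambda>x. x + T) ` r (Suc k)"
          have "x + zmul (int k) T \<in> A" if "x \<in> r k \<union> (\<lambda>x. x + T) ` r (Suc k)" for x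
            using that by (auto simp: r_def zmul_add_left add_ac)
          from this[OF xy(1)] this[OF xy(2)] A
          have "(x + zmul (int k) T) - (y + zmul (int k) T) \<notin> D" unfolding avoiding_def by blast
          then show "x - y \<notin> D" by simp
        qed
      qed (auto simp: r_def)
      ultimately show "real (card {j \<in> {..<N} \<times> B. (case j of (k, b) \<Rightarrow> b + zmul (int k) T) \<in> A}) \<le> \<rho> * real N + c"
        by simp
    qed (use B in simp)
    then show ?thesis by (simp add: X_def card_cartesian_product mult_ac)
  qed
  have lower: "\<rho> * real (q * l) \<le> (real (q * l) + 2) * X" for q
  proof -
    define N where "N = q * l"
    define I where "I = (\<lambda>(k, b). b + zmul (int k) T) ` (SIGMA k:{..<N}. s k)"
    \<comment> \<open>The window has one extra block on each side of the \<open>N\<close> blocks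
      used, hence the factor \<open>N + 2\<close>.\<close>
    define F where "F = (\<lambda>(k, b). b + zmul k T) ` ({-1..int N} \<times> B)"
    have "card F = card ({-1..int N} \<times> B)"
      unfolding F_def by (rule card_image) (auto simp: inj_on_def dest: inj)
    then have cardF: "card F = (N + 2) * card B" by (simp add: card_cartesian_product nat_add_distrib)
    have "card I = card (SIGMA k:{..<N}. s k)"
      unfolding I_def using sB by (intro card_image) (auto simp: inj_on_def dest!: inj[rotated 2])
    also have "\<dots> = (\<Sum>k<N. card (s k))"
      by (intro card_SigmaI ballI finite_subset[OF sB[unfolded Pow_iff] B(1)]) simp
    finally have cardI: "real (card I) = \<rho> * real (q * l)" using sw[of q] by (simp add: N_def)
    have FI: "b + zmul k T \<in> F" if "b \<in> B" "-1 \<le> k" "k \<le> int N" for b k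
      using that by (force simp: F_def)
    have "real (card I) \<le> real (card F) * motzkin_density \<mu> D"
    proof (rule motzkin_density_lower)
      show "finite F" using B by (simp add: F_def)
      show "I \<subseteq> F" using sB by (auto simp: I_def intro!: FI)
      show "avoiding D I"
        unfolding avoiding_def
      proof (intro ballI notI)
        fix x y assume xy: "x \<in> I" "y \<in> I" "x - y \<in> D"
        obtain k b where x: "x = b + zmul (int k) T" "b \<in> s k" using xy by (auto simp: I_def)
        obtain k' b' where y: "y = b' + zmul (int k') T" "b' \<in> s k'" using xy by (auto simp: I_def)
        have bB: "b \<in> B" "b' \<in> B" using x y sB by auto
        have no: False if "u \<in> s j \<union> (\<lambda>x. x + T) ` s (Suc j)" "v \<in> s j \<union> (\<lambda>x. x + T) ` s (Suc j)"
          "u - v \<in> D" for u v j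
          using sE[of j] that unfolding E_def avoiding_def by blast
        \<comment> \<open>Two conflicting points lie in the same block or in consecutive ones, where
          compatibility along \<open>s\<close> forbids the conflict.\<close>
        obtain b'' e where e: "b'' \<in> B" "e \<in> {-1, 0, 1}" "b' + (x - y) = b'' + zmul e T"
          using nbr[OF bB(2), of "x - y"] xy(3) by blast
        have "b + zmul (int k) T = (b' + (x - y)) + zmul (int k') T" using x(1) y(1) by (simp add: algebra_simps)
        then have "b + zmul (int k) T = b'' + zmul (e + int k') T" by (simp add: e(3) zmul_add_left add.assoc)
        from inj[OF bB(1) e(1) this] have "int k = e + int k'" by blast
        with e(2) consider "k = k'" | "k = Suc k'" | "k' = Suc k" by auto
        then show False
        proof cases
          case 1
          then show False using no[of b k b'] x y xy(3) by auto
        next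
          case 2
          then have "(b + T) - b' = x - y" using x y by (simp add: zmul_add_left algebra_simps)
          with xy(3) have "(b + T) - b' \<in> D" by (simp only:)
          then show False using no[of "b + T" k' b'] x(2) y(2) 2 by blast
        next
          case 3
          then have "b - (b' + T) = x - y" using x y by (simp add: zmul_add_left algebra_simps)
          with xy(3) have "b - (b' + T) \<in> D" by (simp only:)
          then show False using no[of b k "b' + T"] x(2) y(2) 3 by blast
        qed
      qed
      have nbrF: "i + d \<in> F" if i: "i \<in> I" and d: "d \<in> D \<union> uminus ` D" for i d
      proof -
        obtain k b where k: "i = b + zmul (int k) T" "b \<in> B" "k < N" using i sB by (auto simp: I_def)
        obtain b' e where e: "b' \<in> B" "e \<in> {-1, 0, 1}" "b + d = b' + zmul e T" using nbr[OF k(2) d] by blast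
        have "i + d = (b + d) + zmul (int k) T" using k(1) by (simp add: algebra_simps)
        also have "\<dots> = b' + zmul (e + int k) T" by (simp add: e(3) zmul_add_left add.assoc)
        also have "\<dots> \<in> F" using e k by (intro FI) auto
        finally show ?thesis .
      qed
      fix i d assume "i \<in> I" "d \<in> D"
      then show "i + d \<in> F \<and> i - d \<in> F" using nbrF[of i d] nbrF[of i "- d"] by auto
    qed
    then show ?thesis using cardI cardF by (simp add: X_def N_def algebra_simps)
  qed
  \<comment> \<open>The boundary terms \<open>c\<close> and \<open>2 * X\<close> do not grow with
    the number of blocks, so both inequalities survive in the limit.\<close>
  have "X - \<rho> \<le> 0"
    by (rule nonpos_of_bounded_multiples[of _ c]) (use upper in \<open>simp add: algebra_simps\<close>)
  moreover have "real l * (\<rho> - X) \<le> 0"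
    by (rule nonpos_of_bounded_multiples[of _ "2 * X"]) (use lower in \<open>simp add: algebra_simps\<close>)
  then have "\<rho> - X \<le> 0" using \<rho>(2) by (simp add: mult_le_0_iff)
  ultimately have "X = \<rho>" by simp
  then have "motzkin_density \<mu> D = \<rho> / real (card B)" using B by (simp add: X_def field_simps)
  moreover have "\<rho> / real (card B) \<in> \<rat>" using \<rho>(1) by simp
  ultimately show ?thesis by (simp only:)
qed

text \<open>The hypothesis says that finitely many cosets of the multiples of \<open>t\<close> are
  closed under the steps. If \<open>t\<close> has finite order their union is finite; otherwise it
  is cut along \<open>t\<close> into blocks longer than any single displacement.\<close>

lemma motzkin_density_rational_virtually_cyclic:
  fixes C :: "'a set" and t :: 'a
  assumes "finite D" and "finite C" "C \<noteq> {}"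
    and "\<And>c d. c \<in> C \<Longrightarrow> d \<in> D \<union> uminus ` D \<Longrightarrow> \<exists>c'\<in>C. \<exists>k. c + d = c' + zmul k t"
  shows "motzkin_density \<mu> D \<in> \<rat>"
proof -
  define good where "good C \<longleftrightarrow> finite C \<and> C \<noteq> {} \<and>
    (\<forall>c\<in>C. \<forall>d\<in>D \<union> uminus ` D. \<exists>c'\<in>C. \<exists>k. c + d = c' + zmul k t)" for C
  have "good C" using assms by (simp add: good_def)
  then obtain C where C: "good C" and least: "\<And>C'. good C' \<Longrightarrow> card C \<le> card C'"
    using ex_has_least_nat[of good C card] by blast
  from C have fC: "finite C" "C \<noteq> {}"
    and nbr: "\<And>c d. c \<in> C \<Longrightarrow> d \<in> D \<union> uminus ` D \<Longrightarrow> \<exists>c'\<in>C. \<exists>k. c + d = c' + zmul k t"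
    unfolding good_def by blast+
  \<comment> \<open>In a \<open>C\<close> of least cardinality the elements represent distinct
    cosets: a second representative \<open>b\<close> could be dropped and replaced by
    \<open>a\<close>.\<close>
  have uniq: "a = b" if ab: "a \<in> C" "b \<in> C" "a + zmul k t = b + zmul k' t" for a b k k'
  proof (rule ccontr)
    assume ne: "a \<noteq> b"
    have b: "b = a + zmul (k - k') t" using ab(3) by (simp add: zmul_diff_left algebra_simps)
    have "good (C - {b})"
      unfolding good_def
    proof (intro conjI ballI)
      fix c d assume "c \<in> C - {b}" "d \<in> D \<union> uminus ` D"
      then obtain c' j where j: "c' \<in> C" "c + d = c' + zmul j t" using nbr[of c d] by blast
      show "\<exists>c'\<in>C - {b}. \<exists>k. c + d = c' + zmul k t"
      proof (cases "c' = b")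
        case True
        have "c + d = a + zmul (k - k' + j) t" using j(2) True b by (simp add: zmul_add_left add.assoc)
        then show ?thesis using ab(1) ne by blast
      qed (use j in blast)
    qed (use fC ab ne in auto)
    from least[OF this] ab(2) fC(1) show False by (metis card_Diff1_less not_less)
  qed
  show ?thesis
  proof (cases "\<exists>m>0. zmul m t = 0")
    case True
    then obtain m where m: "0 < m" "zmul m t = 0" by blast
    have red: "zmul k t = zmul (k mod m) t" for k
    proof -
      have "zmul k t = zmul (k div m * m) t + zmul (k mod m) t" by (simp flip: zmul_add_left)
      then show ?thesis using m(2) by (simp flip: zmul_zmul)
    qed
    show ?thesis
    proof (rule motzkin_density_rational_finite[of "(\<lambda>(c, k). c + zmul k t) ` (C \<times> {0..<m})"])
      fix x d assume x: "x \<in> (\<lambda>(c, k). c + zmul k t) ` (C \<times> {0..<m})" and d: "d \<in> D \<union> uminus ` D"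
      then obtain c k where c: "c \<in> C" "x = c + zmul k t" by auto
      obtain c' j where j: "c' \<in> C" "c + d = c' + zmul j t" using nbr[OF c(1) d] by blast
      have "x + d = (c + d) + zmul k t" using c(2) by (simp add: algebra_simps)
      also have "\<dots> = c' + zmul ((j + k) mod m) t" by (simp add: j(2) zmul_add_left add.assoc flip: red)
      finally show "x + d \<in> (\<lambda>(c, k). c + zmul k t) ` (C \<times> {0..<m})"
        using j(1) m(1) by (intro image_eqI[of _ _ "(c', (j + k) mod m)"]) auto
    qed (use fC m in auto)
  next
    case False
    have tfree: "k = 0" if "zmul k t = 0" for k
    proof (rule ccontr)
      assume "k \<noteq> 0"
      then consider "0 < k" | "0 < - k" by linarith
      then show False using False that zmul_minus_left[of k t] by cases auto
    qed
    have "\<forall>p\<in>C \<times> (D \<union> uminus ` D). \<exists>k. \<exists>c'\<in>C. fst p + snd p = c' + zmul k t"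
    proof
      fix p assume "p \<in> C \<times> (D \<union> uminus ` D)"
      then have "fst p \<in> C" "snd p \<in> D \<union> uminus ` D" by auto
      from nbr[OF this] show "\<exists>k. \<exists>c'\<in>C. fst p + snd p = c' + zmul k t" by blast
    qed
    from bchoice[OF this] obtain \<kappa>
      where \<kappa>': "\<forall>p\<in>C \<times> (D \<union> uminus ` D). \<exists>c'\<in>C. fst p + snd p = c' + zmul (\<kappa> p) t"
      by blast
    have \<kappa>: "\<exists>c'\<in>C. c + d = c' + zmul (\<kappa> (c, d)) t" if "c \<in> C" "d \<in> D \<union> uminus ` D" for c d
      using bspec[OF \<kappa>', of "(c, d)"] that by simp
    \<comment> \<open>\<open>M\<close> exceeds every displacement along \<open>t\<close> caused by
      one step, so a step from a block of length \<open>M\<close> ends in that block or an adjacent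
      one.\<close>
    define M where "M = 1 + (\<Sum>p\<in>C \<times> (D \<union> uminus ` D). \<bar>\<kappa> p\<bar>)"
    have M: "0 < M" by (simp add: M_def add_pos_nonneg sum_nonneg)
    have \<kappa>_le: "\<bar>\<kappa> (c, d)\<bar> < M" if "c \<in> C" "d \<in> D \<union> uminus ` D" for c d
    proof -
      have "\<bar>\<kappa> (c, d)\<bar> \<le> (\<Sum>p\<in>C \<times> (D \<union> uminus ` D). \<bar>\<kappa> p\<bar>)"
        using that fC assms(1) by (intro member_le_sum) auto
      then show ?thesis by (simp add: M_def)
    qed
    define B where "B = (\<lambda>(c, j). c + zmul j t) ` (C \<times> {0..<M})"
    show ?thesis
    proof (rule motzkin_density_rational_blocks[of B "zmul M t"])
      show "finite B" using fC by (simp add: B_def)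
      show "B \<noteq> {}" using fC M by (simp add: B_def)
    next
      fix b b' k k' assume bb: "b \<in> B" "b' \<in> B" and eq: "b + zmul k (zmul M t) = b' + zmul k' (zmul M t)"
      obtain c j where c: "b = c + zmul j t" "c \<in> C" "0 \<le> j" "j < M" using bb by (auto simp: B_def)
      obtain c' j' where c': "b' = c' + zmul j' t" "c' \<in> C" "0 \<le> j'" "j' < M" using bb by (auto simp: B_def)
      have eq': "c + zmul (j + k * M) t = c' + zmul (j' + k' * M) t"
        using eq c c' by (simp add: zmul_zmul zmul_add_left add.assoc)
      then have "c = c'" by (rule uniq[OF c(2) c'(2)])
      with eq' have "zmul ((j + k * M) - (j' + k' * M)) t = 0" by (subst zmul_diff_left) simp
      then have *: "j + k * M = j' + k' * M" using tfree by fastforce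
      then have "(j + k * M) mod M = (j' + k' * M) mod M" by simp
      then have "j = j'" using c c' by simp
      then show "b = b' \<and> k = k'" using * M c c' \<open>c = c'\<close> by simp
    next
      fix b d assume "b \<in> B" and d: "d \<in> D \<union> uminus ` D"
      then obtain c j where c: "b = c + zmul j t" "c \<in> C" "0 \<le> j" "j < M" by (auto simp: B_def)
      define k where "k = j + \<kappa> (c, d)"
      obtain c' where c': "c' \<in> C" "c + d = c' + zmul (\<kappa> (c, d)) t" using \<kappa>[OF c(2) d] by blast
      have kM: "- M \<le> k" "k < 2 * M" using \<kappa>_le[OF c(2) d] c by (auto simp: k_def)
      have "b + d = (c + d) + zmul j t" using c(1) by (simp add: algebra_simps)
      also have "\<dots> = c' + zmul k t" by (simp add: c'(2) k_def zmul_add_left algebra_simps)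
      also have "zmul k t = zmul (k mod M) t + zmul (k div M) (zmul M t)"
        by (simp add: zmul_zmul flip: zmul_add_left)
      finally have "b + d = (c' + zmul (k mod M) t) + zmul (k div M) (zmul M t)" by (simp add: add.assoc)
      moreover have "c' + zmul (k mod M) t \<in> B"
        unfolding B_def using c' M by (intro image_eqI[of _ _ "(c', k mod M)"]) auto
      moreover have "k div M \<in> {-1, 0, 1}"
      proof -
        have "(- 1 * M) div M \<le> k div M" using kM M by (intro zdiv_mono1) simp_all
        then have "-1 \<le> k div M" using M by (simp only: nonzero_mult_div_cancel_right)
        moreover have "k div M < 2"
        proof -
          have "k div M * M + k mod M = k" "0 \<le> k mod M" using M by simp_all
          then have "k div M * M < 2 * M" using kM(2) by linarith
          then show ?thesis using M by (simp only: mult_less_cancel_right_pos)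
        qed
        ultimately show ?thesis by auto
      qed
      ultimately show "\<exists>b'\<in>B. \<exists>k\<in>{-1, 0, 1}. b + d = b' + zmul k (zmul M t)" by blast
    qed
  qed
qed

text \<open>Eliminating \<open>d2\<close> or \<open>d1\<close> from the two relations, as in
  Cramer's rule, shows that the minor \<open>m\<close> times \<open>d1\<close> and \<open>m\<close>
  times \<open>d2\<close> are multiples of \<open>d3\<close>. So the generated group is a finite
  union of cosets of the multiples of \<open>d3\<close>.\<close>

lemma motzkin_density_rational_two_relations:
  fixes d1 d2 d3 :: 'a
  assumes rel: "zmul a d1 + zmul b d2 + zmul c d3 = 0" "zmul x d1 + zmul y d2 + zmul z d3 = 0"
    and ne: "a * y \<noteq> x * b"
  shows "motzkin_density \<mu> {d1, d2, d3} \<in> \<rat>"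
proof -
  define m where "m = a * y - x * b"
  have lin: "zmul (u * a + v * x) d1 + zmul (u * b + v * y) d2 + zmul (u * c + v * z) d3 = 0" for u v
  proof -
    have "zmul (u * a + v * x) d1 + zmul (u * b + v * y) d2 + zmul (u * c + v * z) d3
      = zmul u (zmul a d1 + zmul b d2 + zmul c d3) + zmul v (zmul x d1 + zmul y d2 + zmul z d3)"
      by (simp add: zmul_add_left zmul_add_right zmul_zmul)
    then show ?thesis using rel by simp
  qed
  have m1: "\<exists>p. zmul m d1 = zmul p d3"
  proof -
    have "zmul m d1 + zmul (y * c - b * z) d3 = 0"
      using lin[of y "- b"] by (simp add: m_def algebra_simps)
    then have "zmul m d1 = zmul (- (y * c - b * z)) d3" by (simp only: zmul_minus_left eq_neg_iff_add_eq_0)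
    then show ?thesis by blast
  qed
  have m2: "\<exists>p. zmul m d2 = zmul p d3"
  proof -
    have "zmul m d2 + zmul (a * z - x * c) d3 = 0"
      using lin[of "- x" a] by (simp add: m_def algebra_simps)
    then have "zmul m d2 = zmul (- (a * z - x * c)) d3" by (simp only: zmul_minus_left eq_neg_iff_add_eq_0)
    then show ?thesis by blast
  qed
  define M where "M = \<bar>m\<bar>"
  have M: "0 < M" using ne by (simp add: M_def m_def)
  have "\<exists>p. zmul M d = zmul p d3" if md: "\<exists>p. zmul m d = zmul p d3" for d
  proof (cases "0 \<le> m")
    case False
    obtain p where "zmul m d = zmul p d3" using md by blast
    then have "zmul M d = zmul (- p) d3" using False by (simp add: M_def zmul_minus_left)
    then show ?thesis by blast
  qed (use md in \<open>simp add: M_def\<close>)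
  then obtain p q where pq: "zmul M d1 = zmul p d3" "zmul M d2 = zmul q d3" using m1 m2 by blast
  \<comment> \<open>Coefficients of \<open>d1\<close> and \<open>d2\<close> can be reduced modulo
    \<open>M\<close>, the quotients being absorbed into the coefficient of
    \<open>d3\<close>.\<close>
  define C where "C = (\<lambda>(i, j). zmul i d1 + zmul j d2) ` ({0..<M} \<times> {0..<M})"
  have red: "\<exists>c\<in>C. \<exists>k. zmul i d1 + zmul j d2 + zmul l d3 = c + zmul k d3" for i j l
  proof -
    have dm: "zmul i d = zmul (i div M) (zmul M d) + zmul (i mod M) d" for i and d :: 'a
      by (simp add: zmul_zmul flip: zmul_add_left)
    have "zmul i d1 + zmul j d2 + zmul l d3 = (zmul (i mod M) d1 + zmul (j mod M) d2)
      + zmul (i div M * p + j div M * q + l) d3"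
      by (subst dm[of i], subst dm[of j]) (simp add: pq zmul_zmul zmul_add_left add_ac)
    moreover have "zmul (i mod M) d1 + zmul (j mod M) d2 \<in> C"
      unfolding C_def using M by (intro image_eqI[of _ _ "(i mod M, j mod M)"]) auto
    ultimately show ?thesis by blast
  qed
  show ?thesis
  proof (rule motzkin_density_rational_virtually_cyclic[where C = C and t = d3])
    show "finite C" by (simp add: C_def)
    show "C \<noteq> {}" using M by (simp add: C_def)
    fix c d assume c: "c \<in> C" and d: "d \<in> {d1, d2, d3} \<union> uminus ` {d1, d2, d3}"
    from c obtain i j where c: "c = zmul i d1 + zmul j d2" by (auto simp: C_def)
    have sgn: "\<exists>e. d = zmul e d'" if "d = d' \<or> d = - d'" for d'
      using that zmul_1[of d'] zmul_minus_left[of 1 d'] by metis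
    from d consider "\<exists>e. d = zmul e d1" | "\<exists>e. d = zmul e d2" | "\<exists>e. d = zmul e d3"
      using sgn by blast
    then show "\<exists>c'\<in>C. \<exists>k. c + d = c' + zmul k d3"
    proof cases
      case 1
      then obtain e where "d = zmul e d1" by blast
      then have "c + d = zmul (i + e) d1 + zmul j d2 + zmul 0 d3" by (simp add: c zmul_add_left add_ac)
      then show ?thesis using red[of "i + e" j 0] by simp
    next
      case 2
      then obtain e where "d = zmul e d2" by blast
      then have "c + d = zmul i d1 + zmul (j + e) d2 + zmul 0 d3" by (simp add: c zmul_add_left add_ac)
      then show ?thesis using red[of i "j + e" 0] by simp
    next
      case 3
      then obtain e where "d = zmul e d3" by blast
      then show ?thesis using red[of i j e] by (simp add: c)
    qed
  qed simp
qed

section \<open>Case distinction on the lattice of relations\<close>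

lemma motzkin_density_rational_triple:
  fixes d1 d2 d3 :: 'a
  shows "motzkin_density \<mu> {d1, d2, d3} \<in> \<rat>"
proof -
  define rel where "rel a b c \<longleftrightarrow> zmul a d1 + zmul b d2 + zmul c d3 = 0" for a b c
  \<comment> \<open>Rank at least two is expressed by a nonzero 2 by 2 minor of two relations;
    permuting the generators then moves it to the first two columns.\<close>
  consider (even) "\<forall>a b c. rel a b c \<longrightarrow> even (a + b + c)"
    | (two) a b c x y z where "rel a b c" "rel x y z" "a * y \<noteq> x * b \<or> a * z \<noteq> x * c \<or> b * z \<noteq> y * c"
    | (one) a b c where "rel a b c" "odd (a + b + c)"
        "\<forall>a b c x y z. rel a b c \<longrightarrow> rel x y z \<longrightarrow> a * y = x * b \<and> a * z = x * c \<and> b * z = y * c"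
    by blast
  then show ?thesis
  proof cases
    case even
    then show ?thesis by (intro motzkin_density_rational_bipartite) (simp add: rel_def)
  next
    case two
    then consider "a * y \<noteq> x * b" | "a * z \<noteq> x * c" | "b * z \<noteq> y * c" by blast
    then show ?thesis
    proof cases
      case 1
      then show ?thesis
        using motzkin_density_rational_two_relations[of a d1 b d2 c d3 x y z] two by (simp add: rel_def)
    next
      case 2
      then show ?thesis
        using motzkin_density_rational_two_relations[of a d1 c d3 b d2 x z y] two
        by (simp add: rel_def add_ac insert_commute)
    next
      case 3
      then show ?thesis
        using motzkin_density_rational_two_relations[of b d2 c d3 a d1 y z x] two
        by (simp add: rel_def add_ac insert_commute)
    qed
  next
    case one
    \<comment> \<open>The sign of 0 is taken to be 1, so that \<open>\<epsilon>\<close> is always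
      invertible and each new generator is the old one up to sign.\<close>
    define \<epsilon> where "\<epsilon> k = (if 0 \<le> k then 1 else - 1 :: int)" for k :: int
    have \<epsilon>: "\<epsilon> k * k = \<bar>k\<bar>" "\<epsilon> k * \<epsilon> k = 1" "\<epsilon> k \<noteq> 0" for k by (auto simp: \<epsilon>_def)
    define e1 e2 e3 where "e1 = zmul (\<epsilon> a) d1" and "e2 = zmul (\<epsilon> b) d2" and "e3 = zmul (\<epsilon> c) d3"
    have rel_e: "zmul x e1 + zmul y e2 + zmul z e3 = 0 \<longleftrightarrow> rel (x * \<epsilon> a) (y * \<epsilon> b) (z * \<epsilon> c)" for x y z
      by (simp add: rel_def e1_def e2_def e3_def zmul_zmul)
    have "motzkin_density \<mu> {e1, e2, e3} \<in> \<rat>"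
    proof (rule motzkin_density_rational_odd_cycle[where a = "\<bar>a\<bar>" and b = "\<bar>b\<bar>" and c = "\<bar>c\<bar>"])
      have "\<bar>k\<bar> * \<epsilon> k = k" for k by (auto simp: \<epsilon>_def)
      then show "zmul \<bar>a\<bar> e1 + zmul \<bar>b\<bar> e2 + zmul \<bar>c\<bar> e3 = 0" using one(1) by (simp add: rel_e)
      show "odd (\<bar>a\<bar> + \<bar>b\<bar> + \<bar>c\<bar>)" using one(2) by auto
      fix x y z x' y' z' assume "zmul x e1 + zmul y e2 + zmul z e3 = 0" "zmul x' e1 + zmul y' e2 + zmul z' e3 = 0"
      from one(3)[rule_format, OF this[unfolded rel_e]] \<epsilon>(3)
      show "x * y' = x' * y \<and> x * z' = x' * z \<and> y * z' = y' * z" by (simp add: mult_ac)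
    qed simp_all
    moreover have "avoiding {e1, e2, e3} = avoiding {d1, d2, d3}"
    proof (rule avoiding_cong_sign)
      have "zmul (\<epsilon> k) d = d \<or> zmul (\<epsilon> k) d = - d" for k and d :: 'a
        by (simp add: \<epsilon>_def zmul_minus_left)
      then have e: "e1 = d1 \<or> e1 = - d1" "e2 = d2 \<or> e2 = - d2" "e3 = d3 \<or> e3 = - d3"
        unfolding e1_def e2_def e3_def by blast+
      show "d \<in> {d1, d2, d3} \<or> - d \<in> {d1, d2, d3}" if "d \<in> {e1, e2, e3}" for d
        using that e by auto
      show "d \<in> {e1, e2, e3} \<or> - d \<in> {e1, e2, e3}" if "d \<in> {d1, d2, d3}" for d
        using that e by auto
    qed
    ultimately show ?thesis by (simp add: motzkin_density_def)
  qed
qed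

end

theorem theorem1p1:
  fixes \<mu> :: "'a::{topological_ab_group_add,t2_space} measure"
    and D :: "'a set"
  assumes "compact (UNIV :: 'a set)"
    and "haar_prob \<mu>"
    and "finite D" and "0 \<notin> D" and "card D \<le> 3"
  shows "motzkin_density \<mu> D \<in> \<rat>"
proof -
  interpret haar_group \<mu> using assms(1,2) by unfold_locales
  consider "card D = 0" | "card D = 1" | "card D = 2" | "card D = 3" using assms(5) by linarith
  then show ?thesis
  proof cases
    case 1
    \<comment> \<open>With no forbidden differences, the one-point set is trivially closed under
      steps.\<close>
    then show ?thesis using assms(3) motzkin_density_rational_finite[of "{0}" "{}"] by simp
  next
    case 2
    then obtain d where "D = {d}" by (rule card_1_singletonE)
    then show ?thesis using motzkin_density_rational_triple[of d d d] by simp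
  next
    case 3
    then obtain d d' where "D = {d, d'}" by (auto simp: card_2_iff)
    then show ?thesis using motzkin_density_rational_triple[of d d d'] by simp
  next
    case 4
    then obtain d d' d'' where "D = {d, d', d''}" by (auto simp: card_3_iff)
    then show ?thesis using motzkin_density_rational_triple by simp
  qed
qed

end
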